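(* Let $f:\mathbb{R}^n\to\mathbb{R}$ satisfy: (AS.1) $f$ is twice continuously differentiable on $\mathbb{R}^n$, and $\nabla f$ and $\nabla^2 f$ are Lipschitz continuous on $\mathbb{R}^n$ with constants $L_1$ and $L_2$, respectively; (AS.2) there is a constant $f_{\rm low}$ with $f(x)\ge f_{\rm low}$ for all $x\in\mathbb{R}^n$. Fix the starting point $x_0$ and the constants of the FAR2 algorithm, and set $$\sigma_{\max}=\max\left\{\sigma_0,\ \gamma_2\frac{L_2C_{\rm up}}{3(1-\eta_1)},\ \gamma_2\frac{L_2}{2(1-\eta_1)}\right\}.$$ Then there exists a constant $\kappa_p>0$, independent of $\epsilon$, such that for every $\epsilon\in(0,1)$ the FAR2 algorithm needs at most $$\left\lceil \frac{f(x_0)-f_{\rm low}}{\kappa_p}\,\epsilon^{-3/2}+1\right\rceil$$ successful iterations and at most $$\left\lceil \frac{f(x_0)-f_{\rm low}}{\kappa_p}\,\epsilon^{-3/2}+1\right\rceil\left(\frac32+\frac{3}{2}\,\frac{|\log\gamma_1|}{\log\gamma_2}\right)+\frac{3}{2\log\gamma_2}\log\left(\frac{\sigma_{\max}}{\sigma_0}\right)$$ iterations to compute an iterate $x_k$ such that $\|\nabla f(x_k)\|\le\epsilon$.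
   Context: $\|\cdot\|$ is the Euclidean norm for vectors (spectral norm for matrices), $I$ the identity. For iterates $x_k$ put $g_k=\nabla f(x_k)$, $H_k=\nabla^2 f(x_k)$, $$T_k(s)=f(x_k)+s^Tg_k+\tfrac12 s^TH_ks,\qquad m_k(s)=T_k(s)+\tfrac13\sigma_k\|s\|^3 .$$ The FAR2 algorithm. Constants: $\epsilon\in(0,1)$, $\sigma_0>0$, $\sigma_{\min}\in(0,\sigma_0]$, $\theta_1>0$, $0<\eta_1\le\eta_2<1$, $0<\gamma_1<1<\gamma_2$, $0<C_{\rm low}<C_{\rm up}$, an integer $j_{\max}\ll n$ ($j_{\max}\ge 2$); initial point $x_0$. Initialize $k=0$, $\mathtt{refresh}=1$, $V_0$ the empty matrix. Iteration $k$: Step 1. If $\|g_k\|\le\epsilon$, terminate. Step 2 (step computation). (a) Subspace minimization, producing $\widehat\lambda_k,\widehat s_k,W_k,V_{k+1}$. If $\mathtt{refresh}=1$: start with $V_{k+1}$ empty; for $j=1,\dots,j_{\max}-1$: let $W^{(j)}$ have orthonormal columns spanning the range of $[V_{k+1},g_k]$; set $g^{(j)}=(W^{(j)})^Tg_k$, $H^{(j)}=(W^{(j)})^TH_kW^{(j)}$; find $\widehat\lambda\ge 0$ with $H^{(j)}+\widehat\lambda I$ positive definite and $\widehat\lambda=\sigma_k\|(H^{(j)}+\widehat\lambda I)^{-1}g^{(j)}\|$; set $\widehat s=-(H^{(j)}+\widehat\lambda I)^{-1}g^{(j)}$; if $\|\nabla m_k(W^{(j)}\widehat s)\|\le\frac12\theta_1\|\widehat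 s\|^2$ exit the loop; otherwise append a new basis vector (any choice, keeping the columns orthonormal) to $V_{k+1}$. Output the last computed $\widehat\lambda_k=\widehat\lambda$, $\widehat s_k=\widehat s$, $W_k=W^{(j)}$. If $\mathtt{refresh}=0$: let $W_k$ have orthonormal columns spanning the range of $[V_k,g_k]$, compute $\widehat\lambda_k,\widehat s_k$ in the same way from the projections of $g_k,H_k$ by $W_k$, and set $V_{k+1}=V_k$. Thus $\widehat s_k$ gives the global minimizer $W_k\widehat s_k$ of $m_k$ over the range of $W_k$ (which contains $g_k$) and $\widehat\lambda_k=\sigma_k\|\widehat s_k\|$. (b) If $\|\nabla m_k(W_k\widehat s_k)\|\le\frac12\theta_1\|W_k\widehat s_k\|^2$, set $s_k=W_k\widehat s_k$ and go to Step 3. (c) Otherwise compute the regularized Newton step $s_k=-(H_k+\widehat\lambda_kI)^{-1}g_k$. (d) If $s_k^T(H_k+\widehat\lambda_kI)s_k\le0$ or $\|s_k\|/\|\widehat s_k\|<C_{\rm low}$ or $\|s_k\|/\|\widehat s_k\|>C_{\rm up}$: if $\mathtt{refresh}=1$, recompute $\lambda_k$ and $s_k=-(H_k+\lambda_kI)^{-1}g_k$ such that $m_k(s_k)<m_k(0)$ and $\|\nabla m_k(s_k)\|\le\frac12\theta_1\|s_k\|^2$ (by the secant method applied to $\|(H_k+\lambda I)^{-1}g_k\|-\lambda/\sigma_k=0$) and go to Step 3; if $\mathtt{refresh}=0$, the iteration is unsuccessful: set $x_{k+1}=x_k$, $\sigma_{k+1}=\sigma_k$, $\mathtt{refresh}=1$,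 increase $k$ by one and go to Step 1. Step 3. Compute $\rho_k=\dfrac{f(x_k)-f(x_k+s_k)}{T_k(0)-T_k(s_k)}$. Step 4. If $\rho_k\ge\eta_1$ the iteration is successful and $x_{k+1}=x_k+s_k$; otherwise it is unsuccessful and $x_{k+1}=x_k$. Step 5. Choose $\sigma_{k+1}\in[\max\{\sigma_{\min},\gamma_1\sigma_k\},\sigma_k]$ if $\rho_k\ge\eta_2$; $\sigma_{k+1}=\sigma_k$ if $\rho_k\in[\eta_1,\eta_2)$; $\sigma_{k+1}=\gamma_2\sigma_k$ otherwise. Set $\mathtt{refresh}=0$, increase $k$ by one, go to Step 1. It is understood that every computation requested by the algorithm can be carried out (i.e. the algorithm is well defined along the run considered). *)

theory Defs
  imports "HOL-Analysis.Analysis" "Jordan_Normal_Form.Matrix"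
begin

no_notation scalar_prod (infix \<open>\<bullet>\<close> 70)

section \<open>Smooth functions\<close>

definition grad :: "(real^'n \<Rightarrow> real) \<Rightarrow> real^'n \<Rightarrow> real^'n" where
  "grad f x = (THE g. GDERIV f x :> g)"

definition hess :: "(real^'n \<Rightarrow> real) \<Rightarrow> real^'n \<Rightarrow> real^'n^'n" where
  "hess f x = matrix (frechet_derivative (grad f) (at x))"

definition twice_cont_differentiable :: "(real^'n \<Rightarrow> real) \<Rightarrow> bool" where
  "twice_cont_differentiable f \<longleftrightarrow>
     (\<forall>x. f differentiable at x) \<and> (\<forall>x. grad f differentiable at x) \<and>
     continuous_on UNIV (hess f)"

text \<open>The norm of the type of matrices is the Frobenius norm, so the spectral norm
  is introduced separately.\<close>

definition spectral_norm :: "real^'n^'n \<Rightarrow> real" where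
  "spectral_norm A = onorm (\<lambda>v. A *v v)"

definition AS1 :: "(real^'n \<Rightarrow> real) \<Rightarrow> real \<Rightarrow> real \<Rightarrow> bool" where
  "AS1 f L1 L2 \<longleftrightarrow>
     twice_cont_differentiable f \<and>
     (\<forall>x y. norm (grad f x - grad f y) \<le> L1 * norm (x - y)) \<and>
     (\<forall>x y. spectral_norm (hess f x - hess f y) \<le> L2 * norm (x - y))"

definition AS2 :: "(real^'n \<Rightarrow> real) \<Rightarrow> real \<Rightarrow> bool" where
  "AS2 f f_low \<longleftrightarrow> (\<forall>x. f_low \<le> f x)"


section \<open>Models\<close>

definition quad_model :: "(real^'n \<Rightarrow> real) \<Rightarrow> real^'n \<Rightarrow> real^'n \<Rightarrow> real" where
  "quad_model f x s = f x + s \<bullet> grad f x + 1/2 * (s \<bullet> (hess f x *v s))"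

definition cubic_model :: "(real^'n \<Rightarrow> real) \<Rightarrow> real^'n \<Rightarrow> real \<Rightarrow> real^'n \<Rightarrow> real" where
  "cubic_model f x \<sigma> s = quad_model f x s + 1/3 * \<sigma> * norm s ^ 3"


section \<open>Matrices with a variable number of columns\<close>

text \<open>The number \<open>p\<close> of columns of \<open>V\<^sub>k\<close> and \<open>W\<^sub>k\<close> changes during a run. An
  \<open>n \<times> p\<close> matrix is the list of its \<open>p\<close> columns in \<open>\<real>\<^sup>n\<close>, whereas vectors of \<open>\<real>\<^sup>p\<close>
  and \<open>p \<times> p\<close> matrices are those of the theory \<open>Jordan_Normal_Form.Matrix\<close>.\<close>

type_synonym 'n cols = "(real^'n) list"

definition orthonormal_cols :: "'n::finite cols \<Rightarrow> bool" where
  "orthonormal_cols W \<longleftrightarrow>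
     (\<forall>i<length W. \<forall>j<length W. W ! i \<bullet> W ! j = (if i = j then 1 else 0))"

definition orthonormal_basis_of_range :: "'n::finite cols \<Rightarrow> 'n cols \<Rightarrow> bool" where
  "orthonormal_basis_of_range W A \<longleftrightarrow> orthonormal_cols W \<and> span (set W) = span (set A)"

text \<open>The products \<open>W v\<close>, \<open>W\<^sup>T g\<close> and \<open>W\<^sup>T H W\<close>.\<close>

definition cols_mult :: "'n::finite cols \<Rightarrow> real Matrix.vec \<Rightarrow> real^'n" where
  "cols_mult W v = (\<Sum>i<length W. vec_index v i *\<^sub>R W ! i)"

definition proj_vec :: "'n::finite cols \<Rightarrow> real^'n \<Rightarrow> real Matrix.vec" where
  "proj_vec W g = Matrix.vec (length W) (\<lambda>i. W ! i \<bullet> g)"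

definition proj_mat :: "'n::finite cols \<Rightarrow> real^'n^'n \<Rightarrow> real Matrix.mat" where
  "proj_mat W H = Matrix.mat (length W) (length W) (\<lambda>(i, j). W ! i \<bullet> (H *v W ! j))"

definition euclid_norm :: "real Matrix.vec \<Rightarrow> real" where
  "euclid_norm v = sqrt (scalar_prod v v)"

text \<open>Symmetry is not part of the definition; it is only applied to matrices derived from
  Hessians of twice continuously differentiable functions.\<close>

definition positive_definite :: "nat \<Rightarrow> real Matrix.mat \<Rightarrow> bool" where
  "positive_definite p A \<longleftrightarrow>
     A \<in> carrier_mat p p \<and>
     (\<forall>v \<in> carrier_vec p. v \<noteq> 0\<^sub>v p \<longrightarrow> 0 < scalar_prod v (A *\<^sub>v v))"


section \<open>The algorithm\<close>

record far2_params =
  sigma0 :: real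
  sigma_min :: real
  theta1 :: real
  eta1 :: real
  eta2 :: real
  gamma1 :: real
  gamma2 :: real
  C_low :: real
  C_up :: real
  j_max :: nat

definition valid_params :: "'n::finite itself \<Rightarrow> far2_params \<Rightarrow> bool" where
  "valid_params _ P \<longleftrightarrow>
     0 < sigma0 P \<and> 0 < sigma_min P \<and> sigma_min P \<le> sigma0 P \<and>
     0 < theta1 P \<and>
     0 < eta1 P \<and> eta1 P \<le> eta2 P \<and> eta2 P < 1 \<and>
     0 < gamma1 P \<and> gamma1 P < 1 \<and> 1 < gamma2 P \<and>
     0 < C_low P \<and> C_low P < C_up P \<and>
     2 \<le> j_max P \<and> j_max P < CARD('n)"

record 'n far2_state =
  iterate :: "real^'n"
  sigma :: real
  refresh :: bool
  basis :: "'n cols"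

text \<open>The pair \<open>lam, s\<close> (with a hat in the algorithm) computed from the projections of \<open>g\<close>
  and \<open>H\<close> by \<open>W\<close>; the matrix \<open>B\<close> is the inverse of \<open>W\<^sup>T H W + lam I\<close>.\<close>

definition reduced_solution ::
  "real^'n \<Rightarrow> real^'n^'n \<Rightarrow> real \<Rightarrow> 'n::finite cols \<Rightarrow> real \<Rightarrow> real Matrix.vec \<Rightarrow> bool" where
  "reduced_solution g H \<sigma> W lam s \<longleftrightarrow>
     (let p = length W; A = proj_mat W H + lam \<cdot>\<^sub>m 1\<^sub>m p in
        0 \<le> lam \<and> positive_definite p A \<and>
        (\<exists>B \<in> carrier_mat p p. inverts_mat A B \<and> inverts_mat B A \<and>
           lam = \<sigma> * euclid_norm (B *\<^sub>v proj_vec W g) \<and>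
           s = - (B *\<^sub>v proj_vec W g)))"

text \<open>\<open>refresh_loop P f x \<sigma> j V lam s W V'\<close>: the loop entered at index \<open>j\<close> with columns \<open>V\<close>
  may output \<open>lam, s, W\<close> and end with columns \<open>V'\<close>.\<close>

inductive refresh_loop ::
  "far2_params \<Rightarrow> (real^'n \<Rightarrow> real) \<Rightarrow> real^'n \<Rightarrow> real \<Rightarrow> nat \<Rightarrow> 'n::finite cols \<Rightarrow>
   real \<Rightarrow> real Matrix.vec \<Rightarrow> 'n cols \<Rightarrow> 'n cols \<Rightarrow> bool"
  for P f x \<sigma> where
  exit_loop:
    "\<lbrakk>j \<le> j_max P - 1;
      orthonormal_basis_of_range W (V @ [grad f x]);
      reduced_solution (grad f x) (hess f x) \<sigma> W lam s;
      norm (grad (cubic_model f x \<sigma>) (cols_mult W s)) \<le> 1/2 * theta1 P * (euclid_norm s)\<^sup>2\<rbrakk>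
     \<Longrightarrow> refresh_loop P f x \<sigma> j V lam s W V"
| last_pass:
    "\<lbrakk>j = j_max P - 1;
      orthonormal_basis_of_range W (V @ [grad f x]);
      reduced_solution (grad f x) (hess f x) \<sigma> W lam s;
      \<not> norm (grad (cubic_model f x \<sigma>) (cols_mult W s)) \<le> 1/2 * theta1 P * (euclid_norm s)\<^sup>2;
      orthonormal_cols (V @ [v])\<rbrakk>
     \<Longrightarrow> refresh_loop P f x \<sigma> j V lam s W (V @ [v])"
| next_pass:
    "\<lbrakk>j < j_max P - 1;
      orthonormal_basis_of_range W (V @ [grad f x]);
      reduced_solution (grad f x) (hess f x) \<sigma> W lam s;
      \<not> norm (grad (cubic_model f x \<sigma>) (cols_mult W s)) \<le> 1/2 * theta1 P * (euclid_norm s)\<^sup>2;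
      orthonormal_cols (V @ [v]);
      refresh_loop P f x \<sigma> (Suc j) (V @ [v]) lam' s' W' V'\<rbrakk>
     \<Longrightarrow> refresh_loop P f x \<sigma> j V lam' s' W' V'"

definition subspace_min ::
  "far2_params \<Rightarrow> (real^'n \<Rightarrow> real) \<Rightarrow> 'n::finite far2_state \<Rightarrow>
   real \<Rightarrow> real Matrix.vec \<Rightarrow> 'n cols \<Rightarrow> 'n cols \<Rightarrow> bool" where
  "subspace_min P f S lam s W V' \<longleftrightarrow>
     (if refresh S then refresh_loop P f (iterate S) (sigma S) 1 [] lam s W V'
      else orthonormal_basis_of_range W (basis S @ [grad f (iterate S)]) \<and>
           reduced_solution (grad f (iterate S)) (hess f (iterate S)) (sigma S) W lam s \<and>
           V' = basis S)"

abbreviation shifted :: "real^'n^'n \<Rightarrow> real \<Rightarrow> real^'n^'n" where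
  "shifted H lam \<equiv> H + lam *\<^sub>R Finite_Cartesian_Product.mat 1"

definition newton_step :: "real^'n^'n \<Rightarrow> real^'n \<Rightarrow> real \<Rightarrow> real^'n \<Rightarrow> bool" where
  "newton_step H g lam s \<longleftrightarrow>
     invertible (shifted H lam) \<and> s = - (matrix_inv (shifted H lam) *v g)"

definition small_model_gradient ::
  "far2_params \<Rightarrow> (real^'n \<Rightarrow> real) \<Rightarrow> 'n::finite far2_state \<Rightarrow> real^'n \<Rightarrow> bool" where
  "small_model_gradient P f S s \<longleftrightarrow>
     norm (grad (cubic_model f (iterate S) (sigma S)) s) \<le> 1/2 * theta1 P * (norm s)\<^sup>2"

definition newton_rejected ::
  "far2_params \<Rightarrow> real^'n^'n \<Rightarrow> real \<Rightarrow> real Matrix.vec \<Rightarrow> real^'n \<Rightarrow> bool" where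
  "newton_rejected P H lam sh s \<longleftrightarrow>
     s \<bullet> (shifted H lam *v s) \<le> 0 \<or>
     norm s / euclid_norm sh < C_low P \<or> norm s / euclid_norm sh > C_up P"

text \<open>Step computation. The result is \<open>Some s\<close> if the step \<open>s\<close> is passed on to the computation
  of \<open>\<rho>\<close>, and \<open>None\<close> if the iteration is abandoned as unsuccessful; the last argument is
  \<open>V\<close> for the next iteration.\<close>

inductive compute_step ::
  "far2_params \<Rightarrow> (real^'n \<Rightarrow> real) \<Rightarrow> 'n::finite far2_state \<Rightarrow>
   (real^'n) option \<Rightarrow> 'n cols \<Rightarrow> bool"
  for P f S where
  subspace_accepted:
    "\<lbrakk>subspace_min P f S lamh sh W V';
      small_model_gradient P f S (cols_mult W sh)\<rbrakk>
     \<Longrightarrow> compute_step P f S (Some (cols_mult W sh)) V'"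
| newton_accepted:
    "\<lbrakk>subspace_min P f S lamh sh W V';
      \<not> small_model_gradient P f S (cols_mult W sh);
      newton_step (hess f (iterate S)) (grad f (iterate S)) lamh s;
      \<not> newton_rejected P (hess f (iterate S)) lamh sh s\<rbrakk>
     \<Longrightarrow> compute_step P f S (Some s) V'"
| recomputed:
    "\<lbrakk>subspace_min P f S lamh sh W V';
      \<not> small_model_gradient P f S (cols_mult W sh);
      newton_step (hess f (iterate S)) (grad f (iterate S)) lamh s';
      newton_rejected P (hess f (iterate S)) lamh sh s';
      refresh S;
      newton_step (hess f (iterate S)) (grad f (iterate S)) lam s;
      cubic_model f (iterate S) (sigma S) s < cubic_model f (iterate S) (sigma S) 0;
      small_model_gradient P f S s\<rbrakk>
     \<Longrightarrow> compute_step P f S (Some s) V'"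
| abandoned:
    "\<lbrakk>subspace_min P f S lamh sh W V';
      \<not> small_model_gradient P f S (cols_mult W sh);
      newton_step (hess f (iterate S)) (grad f (iterate S)) lamh s';
      newton_rejected P (hess f (iterate S)) lamh sh s';
      \<not> refresh S\<rbrakk>
     \<Longrightarrow> compute_step P f S None V'"

definition rho :: "(real^'n \<Rightarrow> real) \<Rightarrow> real^'n \<Rightarrow> real^'n \<Rightarrow> real" where
  "rho f x s = (f x - f (x + s)) / (quad_model f x 0 - quad_model f x s)"

definition sigma_update :: "far2_params \<Rightarrow> real \<Rightarrow> real \<Rightarrow> real \<Rightarrow> bool" where
  "sigma_update P r \<sigma> \<sigma>' \<longleftrightarrow>
     (if r \<ge> eta2 P then \<sigma>' \<in> {max (sigma_min P) (gamma1 P * \<sigma>)..\<sigma>}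
      else if r \<ge> eta1 P then \<sigma>' = \<sigma>
      else \<sigma>' = gamma2 P * \<sigma>)"

text \<open>\<open>far2_iteration P f S b S'\<close>: a full iteration may lead from state \<open>S\<close> to state \<open>S'\<close>, and
  it is successful iff \<open>b\<close>.\<close>

inductive far2_iteration ::
  "far2_params \<Rightarrow> (real^'n \<Rightarrow> real) \<Rightarrow> 'n::finite far2_state \<Rightarrow> bool \<Rightarrow> 'n far2_state \<Rightarrow> bool"
  for P f S where
  abandoned_iteration:
    "compute_step P f S None V'
     \<Longrightarrow> far2_iteration P f S False
           \<lparr>iterate = iterate S, sigma = sigma S, refresh = True, basis = V'\<rparr>"
| tested_iteration:
    "\<lbrakk>compute_step P f S (Some s) V';
      b \<longleftrightarrow> rho f (iterate S) s \<ge> eta1 P;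
      sigma_update P (rho f (iterate S) s) (sigma S) \<sigma>'\<rbrakk>
     \<Longrightarrow> far2_iteration P f S b
           \<lparr>iterate = (if b then iterate S + s else iterate S),
            sigma = \<sigma>', refresh = False, basis = V'\<rparr>"

text \<open>A run that has not terminated always continues, since all requested computations can be
  carried out; \<open>S k\<close> and \<open>succ k\<close> are irrelevant for \<open>k\<close> after termination.\<close>

definition far2_run ::
  "far2_params \<Rightarrow> (real^'n \<Rightarrow> real) \<Rightarrow> real^'n \<Rightarrow> real \<Rightarrow>
   (nat \<Rightarrow> 'n::finite far2_state) \<Rightarrow> (nat \<Rightarrow> bool) \<Rightarrow> bool" where
  "far2_run P f x0 \<epsilon> S succ \<longleftrightarrow>
     S 0 = \<lparr>iterate = x0, sigma = sigma0 P, refresh = True, basis = []\<rparr> \<and>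
     (\<forall>k. (\<forall>i\<le>k. \<not> norm (grad f (iterate (S i))) \<le> \<epsilon>) \<longrightarrow>
          far2_iteration P f (S k) (succ k) (S (Suc k)))"

definition sigma_max :: "far2_params \<Rightarrow> real \<Rightarrow> real" where
  "sigma_max P L2 = Max {sigma0 P, gamma2 P * (L2 * C_up P / (3 * (1 - eta1 P))),
                         gamma2 P * (L2 / (2 * (1 - eta1 P)))}"

end

theory Submission
  imports Defs
begin

text \<open>
  Every tested step \<open>s\<close> decreases the quadratic model by at least \<open>c \<sigma> \<parallel>s\<parallel>\<^sup>3\<close>, where
  \<open>c = min (1/3) (1 / (2 C\<^sub>u\<^sub>p))\<close>. The cubic Taylor bound then makes every iteration with large
  \<open>\<sigma>\<close> successful, which keeps \<open>\<sigma>\<close> below \<open>\<sigma>\<^sub>m\<^sub>a\<^sub>x\<close>. As moreover \<open>\<parallel>g + H s\<parallel> = O(\<parallel>s\<parallel>\<^sup>2)\<close>, a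
  successful step reaching a gradient of norm above \<open>\<epsilon>\<close> has \<open>\<parallel>s\<parallel>\<^sup>2 \<ge> \<epsilon> / K\<close> and decreases \<open>f\<close> by a
  multiple of \<open>\<epsilon>\<^sup>3\<^sup>/\<^sup>2\<close>; this bounds the number of successful iterations, and \<open>\<sigma> \<le> \<sigma>\<^sub>m\<^sub>a\<^sub>x\<close> bounds
  the number of unsuccessful tested ones in terms of it.

  An abandoned iteration is always directly preceded by a tested one, so the total is at most
  twice the number of tested iterations. The smaller factor 3/2 of the statement comes from
  the freedom in \<open>\<kappa>\<^sub>p\<close>: because \<open>\<epsilon> < 1\<close>, decreasing \<open>\<kappa>\<^sub>p\<close> (depending on \<open>f x\<^sub>0 - f\<^sub>l\<^sub>o\<^sub>w\<close> and
  \<open>\<sigma>\<^sub>m\<^sub>a\<^sub>x\<close>) absorbs the difference. If \<open>f x\<^sub>0 = f\<^sub>l\<^sub>o\<^sub>w\<close> then \<open>x\<^sub>0\<close> is already stationary.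
\<close>


section \<open>Gradients and Taylor bounds in inner product spaces\<close>

lemma GDERIV_unique:
  assumes "GDERIV f x :> g" and "GDERIV f x :> h"
  shows "g = h"
proof -
  have "(\<lambda>v. v \<bullet> g) = (\<lambda>v. v \<bullet> h)"
    using assms unfolding gderiv_def by (rule has_derivative_unique)
  then have "(g - h) \<bullet> g = (g - h) \<bullet> h" by metis
  then have "(g - h) \<bullet> (g - h) = 0" by (simp add: inner_diff_right)
  then show ?thesis by simp
qed

lemma GDERIV_eq_0_at_minimum:
  assumes "GDERIV f x :> g" and "\<And>y. f x \<le> f y"
  shows "g = 0"
proof -
  have "(\<lambda>h. h \<bullet> g) = (\<lambda>h. 0)"
    by (rule differential_zero_maxmin[of x UNIV f]) (use assms in \<open>auto simp: gderiv_def\<close>)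
  then show ?thesis by (metis inner_eq_zero_iff)
qed

lemma GDERIV_norm_cubed:
  fixes s :: "'a::real_inner"
  shows "GDERIV (\<lambda>s. norm s ^ 3) s :> (3 * norm s) *\<^sub>R s"
proof (cases "s = 0")
  case True
  have "((\<lambda>h. norm h ^ 3 / norm h) \<longlongrightarrow> 0) (at (0::'a))"
  proof (rule Lim_transform_eventually)
    show "((\<lambda>h. norm h ^ 2) \<longlongrightarrow> 0) (at (0::'a))" by (auto intro!: tendsto_eq_intros)
    show "\<forall>\<^sub>F h in at (0::'a). norm h ^ 2 = norm h ^ 3 / norm h"
      by (simp add: eventually_at_filter power2_eq_square power3_eq_cube)
  qed
  then show ?thesis using True by (simp add: gderiv_def has_derivative_at)
next
  case False
  have "((\<lambda>r. r ^ 3) has_real_derivative 3 * norm s ^ 2) (at (norm s))"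
    by (auto intro!: derivative_eq_intros)
  with GDERIV_norm[OF False] have "GDERIV (\<lambda>s. norm s ^ 3) s :> (3 * (norm s)\<^sup>2) *\<^sub>R sgn s"
    by (rule GDERIV_DERIV_compose)
  moreover have "(3 * (norm s)\<^sup>2) *\<^sub>R sgn s = (3 * norm s) *\<^sub>R s"
    using False by (simp add: sgn_div_norm power2_eq_square field_simps)
  ultimately show ?thesis by simp
qed

lemma GDERIV_along_line:
  assumes "GDERIV f (x + t *\<^sub>R s) :> g"
  shows "((\<lambda>t. f (x + t *\<^sub>R s)) has_real_derivative s \<bullet> g) (at t)"
proof -
  have "((\<lambda>t. f (x + t *\<^sub>R s)) has_derivative (\<lambda>h. (h *\<^sub>R s) \<bullet> g)) (at t)"
    using assms unfolding gderiv_def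
    by (rule has_derivative_compose[rotated]) (auto intro!: derivative_eq_intros)
  then show ?thesis by (simp add: has_field_derivative_def mult_commute_abs)
qed

lemma norm_increment_le_power_bound:
  fixes \<phi> :: "real \<Rightarrow> 'a::real_normed_vector"
  assumes deriv: "\<And>t. (\<phi> has_vector_derivative \<phi>' t) (at t)"
    and bound: "\<And>t. 0 < t \<Longrightarrow> t < 1 \<Longrightarrow> norm (\<phi>' t) \<le> c * t ^ n"
  shows "norm (\<phi> 1 - \<phi> 0) \<le> c / Suc n"
proof -
  define \<psi> where "\<psi> t = c / Suc n * t ^ Suc n" for t :: real
  have \<psi>: "(\<psi> has_vector_derivative c * t ^ n) (at t)" for t
    unfolding \<psi>_def has_real_derivative_iff_has_vector_derivative[symmetric]
    by (rule derivative_eq_intros refl | simp)+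
  have "norm (\<phi> 1 - \<phi> 0) \<le> \<psi> 1 - \<psi> 0"
    using deriv \<psi> bound
    by (intro differentiable_bound_general[of 0 1 \<phi> \<psi> \<phi>' "\<lambda>t. c * t ^ n"])
      (auto intro!: continuous_at_imp_continuous_on has_vector_derivative_continuous)
  then show ?thesis by (simp add: \<psi>_def)
qed

lemma linearization_error_le:
  fixes F :: "'a::real_normed_vector \<Rightarrow> 'b::real_normed_vector"
  assumes deriv: "\<And>y. (F has_derivative F' y) (at y)"
    and lipschitz: "\<And>y. onorm (\<lambda>h. F' y h - F' x h) \<le> L * norm (y - x)"
  shows "norm (F (x + s) - F x - F' x s) \<le> L / 2 * (norm s)\<^sup>2"
proof -
  have linear: "bounded_linear (F' y)" for y using deriv by (rule has_derivative_bounded_linear)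
  define \<phi> where "\<phi> t = F (x + t *\<^sub>R s) - t *\<^sub>R F' x s" for t
  have "(\<phi> has_vector_derivative F' (x + t *\<^sub>R s) s - F' x s) (at t)" for t
  proof -
    have "((\<lambda>t. F (x + t *\<^sub>R s)) has_derivative (\<lambda>h. F' (x + t *\<^sub>R s) (h *\<^sub>R s))) (at t)"
      using deriv by (rule has_derivative_compose[rotated]) (auto intro!: derivative_eq_intros)
    then have "((\<lambda>t. F (x + t *\<^sub>R s)) has_vector_derivative F' (x + t *\<^sub>R s) s) (at t)"
      by (simp add: has_vector_derivative_def linear_cmul[OF bounded_linear.linear[OF linear]])
    then show ?thesis unfolding \<phi>_def by (auto intro!: derivative_eq_intros)
  qed
  moreover have "norm (F' (x + t *\<^sub>R s) s - F' x s) \<le> (L * (norm s)\<^sup>2) * t ^ 1" if "0 < t" for t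
  proof -
    have "norm (F' (x + t *\<^sub>R s) s - F' x s)
        \<le> onorm (\<lambda>h. F' (x + t *\<^sub>R s) h - F' x h) * norm s"
      using linear by (intro onorm bounded_linear_sub)
    also have "\<dots> \<le> L * norm (t *\<^sub>R s) * norm s"
      using lipschitz[of "x + t *\<^sub>R s"] by (intro mult_right_mono) auto
    finally show ?thesis using that by (simp add: power2_eq_square ac_simps)
  qed
  ultimately have "norm (\<phi> 1 - \<phi> 0) \<le> L * (norm s)\<^sup>2 / Suc 1"
    by (rule norm_increment_le_power_bound)
  then show ?thesis by (simp add: \<phi>_def algebra_simps)
qed

lemma quadratic_taylor_error_le:
  fixes f :: "'a::real_inner \<Rightarrow> real"
  assumes gradient: "\<And>y. GDERIV f y :> g y" and derivative: "\<And>y. (g has_derivative H y) (at y)"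
    and lipschitz: "\<And>y. onorm (\<lambda>h. H y h - H x h) \<le> L * norm (y - x)"
  shows "\<bar>f (x + s) - (f x + s \<bullet> g x + 1/2 * (s \<bullet> H x s))\<bar> \<le> L / 6 * norm s ^ 3"
proof -
  define \<phi> where "\<phi> t = f (x + t *\<^sub>R s) - t * (s \<bullet> g x) - t\<^sup>2 / 2 * (s \<bullet> H x s)" for t
  have H_scale: "H x (t *\<^sub>R s) = t *\<^sub>R H x s" for t
    using has_derivative_linear[OF derivative] by (rule linear_cmul)
  have "(\<phi> has_vector_derivative s \<bullet> (g (x + t *\<^sub>R s) - g x - H x (t *\<^sub>R s))) (at t)" for t
    unfolding \<phi>_def has_real_derivative_iff_has_vector_derivative[symmetric]
    by (auto intro!: derivative_eq_intros GDERIV_along_line gradient simp: H_scale inner_diff_right)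
  moreover have "norm (s \<bullet> (g (x + t *\<^sub>R s) - g x - H x (t *\<^sub>R s))) \<le> (L / 2 * norm s ^ 3) * t\<^sup>2"
    for t
  proof -
    have "norm (s \<bullet> (g (x + t *\<^sub>R s) - g x - H x (t *\<^sub>R s)))
        \<le> norm s * norm (g (x + t *\<^sub>R s) - g x - H x (t *\<^sub>R s))"
      by (simp add: Cauchy_Schwarz_ineq2)
    also have "\<dots> \<le> norm s * (L / 2 * (norm (t *\<^sub>R s))\<^sup>2)"
      by (intro mult_left_mono linearization_error_le derivative lipschitz) simp
    finally show ?thesis by (simp add: power2_eq_square power3_eq_cube ac_simps)
  qed
  ultimately have "norm (\<phi> 1 - \<phi> 0) \<le> L / 2 * norm s ^ 3 / Suc 2"
    by (rule norm_increment_le_power_bound)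
  then show ?thesis by (simp add: \<phi>_def algebra_simps)
qed

lemma second_difference_error_le:
  fixes f :: "'a::real_inner \<Rightarrow> real"
  assumes gradient: "\<And>y. GDERIV f y :> g y" and linear: "linear H"
    and error: "\<And>h. norm h \<le> norm u + norm v \<Longrightarrow> norm (g (x + h) - g x - H h) \<le> e * norm h"
    and e_nonneg: "0 \<le> e"
  shows "\<bar>f (x + u + v) - f (x + u) - f (x + v) + f x - v \<bullet> H u\<bar> \<le> 2 * e * (norm u + norm v)\<^sup>2"
proof -
  have "\<exists>t. 0 < t \<and> t < 1 \<and>
      (f (x + u + 1 *\<^sub>R v) - f (x + 1 *\<^sub>R v)) - (f (x + u + 0 *\<^sub>R v) - f (x + 0 *\<^sub>R v))
        = (1 - 0) * (v \<bullet> g (x + u + t *\<^sub>R v) - v \<bullet> g (x + t *\<^sub>R v))"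
    by (rule MVT2) (auto intro!: derivative_intros GDERIV_along_line gradient)
  then obtain t where t: "0 < t" "t < 1"
    and mvt: "f (x + u + v) - f (x + u) - f (x + v) + f x
               = v \<bullet> (g (x + (u + t *\<^sub>R v)) - g (x + t *\<^sub>R v))"
    by (auto simp: inner_diff_right algebra_simps)
  define R where "R = norm u + norm v"
  define r where "r h = g (x + h) - g x - H h" for h
  have r_le: "norm (r h) \<le> e * R" if "norm h \<le> R" for h
    using error[of h] mult_left_mono[OF that e_nonneg] that by (simp add: r_def R_def)
  have "norm (t *\<^sub>R v) \<le> norm v" using t by (simp add: mult_left_le_one_le)
  then have small: "norm (u + t *\<^sub>R v) \<le> R" "norm (t *\<^sub>R v) \<le> R"
    using norm_triangle_ineq[of u "t *\<^sub>R v"] unfolding R_def by (auto intro: order_trans)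
  have "g (x + (u + t *\<^sub>R v)) - g (x + t *\<^sub>R v) - H u = r (u + t *\<^sub>R v) - r (t *\<^sub>R v)"
    by (simp add: r_def linear_add[OF linear])
  then have "\<bar>f (x + u + v) - f (x + u) - f (x + v) + f x - v \<bullet> H u\<bar>
      = \<bar>v \<bullet> (r (u + t *\<^sub>R v) - r (t *\<^sub>R v))\<bar>"
    unfolding mvt inner_diff_right[symmetric] by simp
  also have "\<dots> \<le> norm v * norm (r (u + t *\<^sub>R v) - r (t *\<^sub>R v))"
    by (rule Cauchy_Schwarz_ineq2)
  also have "\<dots> \<le> R * (e * R + e * R)"
    using r_le small e_nonneg
    by (intro mult_mono norm_triangle_le_diff add_mono) (auto simp: R_def)
  finally show ?thesis by (simp add: R_def power2_eq_square algebra_simps)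
qed

text \<open>The second difference of \<open>f\<close> is symmetric in \<open>u\<close> and \<open>v\<close>, hence so is its leading term.\<close>

lemma second_derivative_symmetric:
  fixes f :: "'a::real_inner \<Rightarrow> real"
  assumes gradient: "\<And>y. GDERIV f y :> g y" and derivative: "(g has_derivative H) (at x)"
  shows "u \<bullet> H v = v \<bullet> H u"
proof -
  have linear: "linear H" using derivative by (rule has_derivative_linear)
  define R where "R = norm u + norm v"
  have "0 \<le> R" by (simp add: R_def)
  have small: "\<bar>u \<bullet> H v - v \<bullet> H u\<bar> \<le> 4 * e * R\<^sup>2" if "0 < e" for e
  proof -
    obtain d where "0 < d" and d: "\<And>h. norm h < d \<Longrightarrow> norm (g (x + h) - g x - H h) \<le> e * norm h"
      using derivative \<open>0 < e\<close> unfolding has_derivative_at_alt by (metis add_diff_cancel_left')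
    define t where "t = d / (R + 1)"
    have t: "0 < t" "t * R < d"
      using \<open>0 < d\<close> \<open>0 \<le> R\<close> by (auto simp: t_def field_simps)
    let ?u = "t *\<^sub>R u" and ?v = "t *\<^sub>R v"
    have tR: "norm ?u + norm ?v = t * R" using t by (simp add: R_def distrib_left)
    have "\<bar>?u \<bullet> H ?v - ?v \<bullet> H ?u\<bar> \<le> 4 * e * (t * R)\<^sup>2"
      using second_difference_error_le[OF gradient linear, of ?u ?v x e]
        second_difference_error_le[OF gradient linear, of ?v ?u x e] d t(2) \<open>0 < e\<close>
      unfolding tR add.commute[of "norm ?v"] by (simp add: add.commute add.left_commute)
    moreover have "?u \<bullet> H ?v - ?v \<bullet> H ?u = t\<^sup>2 * (u \<bullet> H v - v \<bullet> H u)"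
      by (simp add: linear_cmul[OF linear] power2_eq_square algebra_simps)
    ultimately have "t\<^sup>2 * \<bar>u \<bullet> H v - v \<bullet> H u\<bar> \<le> t\<^sup>2 * (4 * e * R\<^sup>2)"
      by (simp add: abs_mult power_mult_distrib ac_simps)
    then show ?thesis using t by simp
  qed
  have "\<bar>u \<bullet> H v - v \<bullet> H u\<bar> \<le> 0 + \<delta>" if "0 < \<delta>" for \<delta>
  proof -
    have "4 * (\<delta> / (4 * R\<^sup>2 + 1)) * R\<^sup>2 \<le> \<delta>"
      using that by (simp add: field_simps add_pos_nonneg)
    then show ?thesis using small[of "\<delta> / (4 * R\<^sup>2 + 1)"] that by (simp add: add_nonneg_pos)
  qed
  then have "\<bar>u \<bullet> H v - v \<bullet> H u\<bar> \<le> 0" by (rule field_le_epsilon)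
  then show ?thesis by simp
qed


section \<open>Objectives with Lipschitz continuous Hessian\<close>

lemma GDERIV_grad:
  fixes f :: "real^'n \<Rightarrow> real"
  assumes "f differentiable at x"
  shows "GDERIV f x :> grad f x"
proof -
  from assms obtain D where D: "(f has_derivative D) (at x)"
    by (auto simp: differentiable_def)
  have "D = (\<lambda>h. h \<bullet> adjoint D 1)"
    using adjoint_works[OF has_derivative_linear[OF D], of _ 1] by (simp add: fun_eq_iff)
  with D have "GDERIV f x :> adjoint D 1" by (simp add: gderiv_def)
  then show ?thesis
    unfolding grad_def using GDERIV_unique by (metis (mono_tags) theI)
qed

lemma grad_eqI:
  fixes f :: "real^'n \<Rightarrow> real"
  assumes "GDERIV f x :> g"
  shows "grad f x = g"
  unfolding grad_def using assms GDERIV_unique by (intro the_equality) blast+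

lemma has_derivative_grad:
  fixes f :: "real^'n \<Rightarrow> real"
  assumes "grad f differentiable at x"
  shows "(grad f has_derivative (\<lambda>h. hess f x *v h)) (at x)"
  using assms unfolding jacobian_works hess_def jacobian_def .

lemma hess_symmetric:
  fixes f :: "real^'n \<Rightarrow> real"
  assumes "\<And>y. f differentiable at y" and "grad f differentiable at x"
  shows "u \<bullet> (hess f x *v v) = v \<bullet> (hess f x *v u)"
  by (rule second_derivative_symmetric[OF GDERIV_grad has_derivative_grad]) (fact assms)+

lemma GDERIV_quad_model:
  fixes f :: "real^'n \<Rightarrow> real"
  assumes "\<And>y. f differentiable at y" and "grad f differentiable at x"
  shows "GDERIV (quad_model f x) s :> grad f x + hess f x *v s"
proof -
  have "((\<lambda>s. hess f x *v s) has_derivative (\<lambda>h. hess f x *v h)) (at s)"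
    by (rule bounded_linear_imp_has_derivative) (rule matrix_vector_mul_bounded_linear)
  then have "(quad_model f x has_derivative
     (\<lambda>h. h \<bullet> grad f x + 1/2 * (s \<bullet> (hess f x *v h) + h \<bullet> (hess f x *v s)))) (at s)"
    unfolding quad_model_def[abs_def] by (auto intro!: derivative_eq_intros)
  then show ?thesis
    by (simp add: gderiv_def hess_symmetric[OF assms, of s] inner_add_right)
qed

lemma grad_cubic_model:
  fixes f :: "real^'n \<Rightarrow> real"
  assumes "\<And>y. f differentiable at y" and "grad f differentiable at x"
  shows "grad (cubic_model f x \<sigma>) s = grad f x + hess f x *v s + (\<sigma> * norm s) *\<^sub>R s"
  using GDERIV_add[OF GDERIV_quad_model[OF assms]
      GDERIV_mult[OF GDERIV_const[of "1/3 * \<sigma>"] GDERIV_norm_cubed]]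
  by (intro grad_eqI) (simp add: cubic_model_def[abs_def])

locale lipschitz_hessian =
  fixes f :: "real^'n \<Rightarrow> real" and L :: real
  assumes differentiable: "f differentiable at x"
    and grad_differentiable: "grad f differentiable at x"
    and hess_lipschitz: "spectral_norm (hess f x - hess f y) \<le> L * norm (x - y)"
begin

lemma lipschitz_constant_nonneg: "0 \<le> L"
proof -
  have "0 \<le> spectral_norm (hess f (axis undefined 1) - hess f 0)"
    unfolding spectral_norm_def by (rule onorm_pos_le) (rule matrix_vector_mul_bounded_linear)
  also have "\<dots> \<le> L * norm (axis undefined 1 - 0 :: real^'n)" by (rule hess_lipschitz)
  finally show ?thesis by (simp add: norm_axis_1)
qed

lemma onorm_hess_diff_le: "onorm (\<lambda>h. hess f y *v h - hess f x *v h) \<le> L * norm (y - x)"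
  using hess_lipschitz[of y x] by (simp add: spectral_norm_def matrix_vector_mult_diff_rdistrib)

lemma grad_linearization_error:
  "norm (grad f (x + s) - grad f x - hess f x *v s) \<le> L / 2 * (norm s)\<^sup>2"
  by (intro linearization_error_le has_derivative_grad grad_differentiable onorm_hess_diff_le)

lemma quad_model_error: "\<bar>f (x + s) - quad_model f x s\<bar> \<le> L / 6 * norm s ^ 3"
  unfolding quad_model_def
  by (intro quadratic_taylor_error_le GDERIV_grad has_derivative_grad
      differentiable grad_differentiable onorm_hess_diff_le)

end

lemma AS1_imp_lipschitz_hessian: "AS1 f L1 L2 \<Longrightarrow> lipschitz_hessian f L2"
  by unfold_locales (auto simp: AS1_def twice_cont_differentiable_def)


section \<open>Matrices with orthonormal columns\<close>

lemma proj_vec_carrier [simp]: "proj_vec W g \<in> carrier_vec (length W)"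
  by (simp add: proj_vec_def)

lemma proj_mat_carrier [simp]: "proj_mat W H \<in> carrier_mat (length W) (length W)"
  by (simp add: proj_mat_def)

lemma scalar_prod_proj_vec:
  assumes "dim_vec v = length W"
  shows "scalar_prod v (proj_vec W g) = cols_mult W v \<bullet> g"
  using assms
  by (simp add: scalar_prod_def proj_vec_def cols_mult_def inner_sum_left atLeast0LessThan)

lemma proj_mat_mult_vec:
  assumes "dim_vec v = length W"
  shows "proj_mat W H *\<^sub>v v = proj_vec W (H *v cols_mult W v)"
proof (rule eq_vecI)
  fix i assume "i < dim_vec (proj_vec W (H *v cols_mult W v))"
  then have i: "i < length W" by (simp add: proj_vec_def)
  have "H *v cols_mult W v = (\<Sum>j<length W. vec_index v j *\<^sub>R (H *v W ! j))"
    unfolding cols_mult_def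
    by (simp add: linear_sum[OF matrix_vector_mul_linear] matrix_vector_mult_scaleR)
  then show "vec_index (proj_mat W H *\<^sub>v v) i = vec_index (proj_vec W (H *v cols_mult W v)) i"
    using i assms
    by (simp add: proj_mat_def proj_vec_def scalar_prod_def inner_sum_right atLeast0LessThan
        mult.commute)
qed (simp add: proj_mat_def proj_vec_def)

lemma proj_vec_cols_mult:
  assumes "orthonormal_cols W" and "dim_vec v = length W"
  shows "proj_vec W (cols_mult W v) = v"
proof (rule eq_vecI)
  fix i assume "i < dim_vec v"
  with assms have i: "i < length W" by simp
  have "W ! i \<bullet> cols_mult W v = (\<Sum>j<length W. if i = j then vec_index v j else 0)"
    unfolding cols_mult_def inner_sum_right
    using assms(1) i by (intro sum.cong) (auto simp: orthonormal_cols_def)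
  then show "vec_index (proj_vec W (cols_mult W v)) i = vec_index v i"
    using i by (simp add: proj_vec_def)
qed (simp add: proj_vec_def assms)

lemma norm_cols_mult:
  assumes "orthonormal_cols W" and "dim_vec v = length W"
  shows "norm (cols_mult W v) = euclid_norm v"
proof -
  have "cols_mult W v \<bullet> cols_mult W v = scalar_prod v v"
    using scalar_prod_proj_vec[OF assms(2), of "cols_mult W v"] proj_vec_cols_mult[OF assms] by simp
  then show ?thesis by (simp add: norm_eq_sqrt_inner euclid_norm_def)
qed

lemma proj_vec_eq_0_imp_eq_0:
  assumes "proj_vec W g = 0\<^sub>v (length W)" and "g \<in> span (set W)"
  shows "g = 0"
proof -
  have orthogonal: "w \<bullet> g = 0" if "w \<in> set W" for w
  proof -
    from that obtain i where "i < length W" "w = W ! i" by (auto simp: in_set_conv_nth)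
    then show ?thesis
      using arg_cong[OF assms(1), of "\<lambda>v. vec_index v i"] by (simp add: proj_vec_def)
  qed
  have "y \<bullet> g = 0" if "y \<in> span (set W)" for y
    using that by (induction rule: span_induct) (auto simp: subspace_def inner_add_left orthogonal)
  with assms(2) show ?thesis by (metis inner_eq_zero_iff)
qed

lemma shifted_mult: "shifted H lam *v s = H *v s + lam *\<^sub>R s"
  by (simp add: matrix_vector_mult_add_rdistrib scaleR_matrix_vector_assoc[symmetric])

lemma inner_shifted_mult: "s \<bullet> (shifted H lam *v s) = s \<bullet> (H *v s) + lam * (norm s)\<^sup>2"
  by (simp add: shifted_mult inner_add_right power2_norm_eq_inner)

lemma proj_mat_shifted:
  assumes "orthonormal_cols W"
  shows "proj_mat W (shifted H lam) = proj_mat W H + lam \<cdot>\<^sub>m 1\<^sub>m (length W)"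
  by (rule eq_matI) (use assms in \<open>auto simp: proj_mat_def orthonormal_cols_def shifted_mult
      inner_add_right\<close>)


section \<open>Regularized steps\<close>

text \<open>Says that \<open>t \<mapsto> t * (s \<bullet> g) + t\<^sup>2 / 2 * (s \<bullet> (H + lam I) s)\<close> is strictly convex with
  minimizer \<open>t = 1\<close>, which both subspace minimizers and accepted Newton steps satisfy.\<close>

definition galerkin_step :: "real^'n^'n \<Rightarrow> real^'n \<Rightarrow> real \<Rightarrow> real^'n \<Rightarrow> bool" where
  "galerkin_step H g lam s \<longleftrightarrow>
     s \<bullet> g = - (s \<bullet> (shifted H lam *v s)) \<and> 0 < s \<bullet> (shifted H lam *v s)"

lemma galerkin_step_nonzero: "galerkin_step H g lam s \<Longrightarrow> s \<noteq> 0"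
  by (auto simp: galerkin_step_def)

lemma galerkin_step_quad_model_decrease:
  assumes "galerkin_step (hess f x) (grad f x) lam s"
  shows "lam / 2 * (norm s)\<^sup>2 \<le> quad_model f x 0 - quad_model f x s"
  using assms by (simp add: galerkin_step_def inner_shifted_mult quad_model_def)

lemma newton_step_shifted_mult:
  assumes "newton_step H g lam s"
  shows "shifted H lam *v s = - g"
proof -
  have "shifted H lam ** matrix_inv (shifted H lam) = Finite_Cartesian_Product.mat 1"
    unfolding matrix_inv_def
    by (rule someI2_ex) (use assms in \<open>auto simp: newton_step_def invertible_def\<close>)
  then show ?thesis
    using assms
    by (simp add: newton_step_def linear_neg[OF matrix_vector_mul_linear] matrix_vector_mul_assoc)
qed

lemma newton_step_residual:
  assumes "newton_step H g lam s"
  shows "g + H *v s = - (lam *\<^sub>R s)"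
  using newton_step_shifted_mult[OF assms] unfolding shifted_mult
  by (simp add: eq_neg_iff_add_eq_0 add.commute add.left_commute)

lemma newton_step_galerkin:
  assumes "newton_step H g lam s" and "0 < s \<bullet> (shifted H lam *v s)"
  shows "galerkin_step H g lam s"
  using assms(2) unfolding galerkin_step_def newton_step_shifted_mult[OF assms(1)] by simp

lemma reduced_solution_dim:
  assumes "reduced_solution g H \<sigma> W lam s"
  shows "s \<in> carrier_vec (length W)"
  using assms by (auto simp: reduced_solution_def Let_def intro!: mult_mat_vec_carrier)

lemma reduced_solution_lam:
  assumes "reduced_solution g H \<sigma> W lam s"
  shows "lam = \<sigma> * euclid_norm s"
  using assms by (auto simp: reduced_solution_def Let_def euclid_norm_def)

lemma reduced_solution_mult_vec:
  assumes "reduced_solution g H \<sigma> W lam s"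
  shows "(proj_mat W H + lam \<cdot>\<^sub>m 1\<^sub>m (length W)) *\<^sub>v s = - proj_vec W g"
proof -
  define p where "p = length W"
  define A where "A = proj_mat W H + lam \<cdot>\<^sub>m 1\<^sub>m p"
  obtain B where B: "B \<in> carrier_mat p p" "inverts_mat A B" and s: "s = - (B *\<^sub>v proj_vec W g)"
    using assms unfolding reduced_solution_def Let_def A_def p_def by blast
  have carrier_A: "A \<in> carrier_mat p p" by (simp add: A_def p_def)
  have carrier_g: "proj_vec W g \<in> carrier_vec p" by (simp add: p_def)
  have "A *\<^sub>v s = - (A *\<^sub>v (B *\<^sub>v proj_vec W g))"
    unfolding s by (rule eq_vecI) (use carrier_A B(1) in auto)
  also have "A *\<^sub>v (B *\<^sub>v proj_vec W g) = proj_vec W g"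
    using assoc_mult_mat_vec[OF carrier_A B(1) carrier_g, symmetric] B(2) carrier_A carrier_g
    by (simp add: inverts_mat_def)
  finally show ?thesis by (simp add: A_def p_def)
qed

lemma reduced_solution_galerkin:
  assumes W: "orthonormal_cols W" "g \<in> span (set W)" and g_nonzero: "g \<noteq> 0"
    and red: "reduced_solution g H \<sigma> W lam s"
  shows "galerkin_step H g lam (cols_mult W s)"
proof -
  let ?A = "proj_mat W (shifted H lam)" and ?z = "cols_mult W s"
  have carrier_s: "s \<in> carrier_vec (length W)" using red by (rule reduced_solution_dim)
  then have dim: "dim_vec s = length W" by simp
  have projected_equation: "?A *\<^sub>v s = - proj_vec W g"
    unfolding proj_mat_shifted[OF W(1)] using red by (rule reduced_solution_mult_vec)
  have quadratic_form: "scalar_prod s (?A *\<^sub>v s) = ?z \<bullet> (shifted H lam *v ?z)"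
    by (simp add: proj_mat_mult_vec[OF dim] scalar_prod_proj_vec[OF dim])
  have "?z \<bullet> g = - (?z \<bullet> (shifted H lam *v ?z))"
    using scalar_prod_proj_vec[OF dim, of g] dim
    unfolding quadratic_form[symmetric] projected_equation by (simp add: proj_vec_def)
  moreover have "s \<noteq> 0\<^sub>v (length W)"
  proof
    assume "s = 0\<^sub>v (length W)"
    moreover have "?A *\<^sub>v 0\<^sub>v (length W) = 0\<^sub>v (length W)"
      by (rule eq_vecI) (auto simp: proj_mat_def)
    ultimately have "proj_vec W g = 0\<^sub>v (length W)"
      using arg_cong[OF projected_equation, of uminus] by simp
    then show False using proj_vec_eq_0_imp_eq_0 W(2) g_nonzero by blast
  qed
  then have "0 < scalar_prod s (?A *\<^sub>v s)"
    using red carrier_s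
    unfolding proj_mat_shifted[OF W(1)] reduced_solution_def positive_definite_def Let_def by blast
  ultimately show ?thesis by (simp add: galerkin_step_def quadratic_form)
qed

lemma refresh_loop_output:
  assumes "refresh_loop P f x \<sigma> j V lam s W V'"
  shows "orthonormal_cols W \<and> grad f x \<in> span (set W) \<and>
    reduced_solution (grad f x) (hess f x) \<sigma> W lam s"
  using assms by induction (auto simp: orthonormal_basis_of_range_def intro: span_base)

lemma subspace_min_output:
  assumes "subspace_min P f S lam s W V'"
  shows "orthonormal_cols W" and "grad f (iterate S) \<in> span (set W)"
    and "reduced_solution (grad f (iterate S)) (hess f (iterate S)) (sigma S) W lam s"
  using assms refresh_loop_output[of P f "iterate S" "sigma S" 1 "[]" lam s W V']
  by (auto simp: subspace_min_def orthonormal_basis_of_range_def intro: span_base split: if_splits)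

lemma subspace_min_galerkin:
  assumes "subspace_min P f S lam s W V'" and "grad f (iterate S) \<noteq> 0"
  shows "galerkin_step (hess f (iterate S)) (grad f (iterate S)) lam (cols_mult W s)"
  using reduced_solution_galerkin subspace_min_output[OF assms(1)] assms(2) by blast

lemma subspace_min_norm:
  assumes "subspace_min P f S lam s W V'"
  shows "norm (cols_mult W s) = euclid_norm s"
  using norm_cols_mult subspace_min_output[OF assms] reduced_solution_dim carrier_vecD by blast

lemma subspace_min_lam:
  assumes "subspace_min P f S lam s W V'"
  shows "lam = sigma S * euclid_norm s"
  using subspace_min_output(3)[OF assms] by (rule reduced_solution_lam)


section \<open>Iterations\<close>

locale far2 = lipschitz_hessian f L2
  for f :: "real^'n \<Rightarrow> real" and L2 :: real +
  fixes P :: far2_params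
  assumes valid: "valid_params TYPE('n) P"
begin

lemma params_pos:
  shows sigma0_pos: "0 < sigma0 P" and sigma_min_pos: "0 < sigma_min P"
    and theta1_pos: "0 < theta1 P" and eta1_pos: "0 < eta1 P" and gamma1_pos: "0 < gamma1 P"
    and C_low_pos: "0 < C_low P" and C_up_pos: "0 < C_up P"
  using valid by (auto simp: valid_params_def)

lemma params_order:
  shows sigma_min_le_sigma0: "sigma_min P \<le> sigma0 P"
    and eta1_less_1: "eta1 P < 1" and eta1_le_eta2: "eta1 P \<le> eta2 P"
    and gamma1_less_1: "gamma1 P < 1" and gamma2_gt_1: "1 < gamma2 P"
  using valid by (auto simp: valid_params_def)

abbreviation sigma_range :: "real set" where
  "sigma_range \<equiv> {sigma_min P..sigma_max P L2}"

abbreviation predicted_decrease :: "'n far2_state \<Rightarrow> real^'n \<Rightarrow> real" where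
  "predicted_decrease S s \<equiv> quad_model f (iterate S) 0 - quad_model f (iterate S) s"

abbreviation model_residual :: "'n far2_state \<Rightarrow> real^'n \<Rightarrow> real^'n" where
  "model_residual S s \<equiv> grad f (iterate S) + hess f (iterate S) *v s"

text \<open>The two arguments of \<open>min\<close> stem from steps with a small model gradient and from Newton steps,
  and so do the terms \<open>theta1 P / 2 + \<sigma>\<close> and \<open>\<sigma> / C_low P\<close>.\<close>

definition decrease_const :: real where
  "decrease_const = min (1/3) (1 / (2 * C_up P))"

definition residual_const :: "real \<Rightarrow> real" where
  "residual_const \<sigma> = theta1 P / 2 + \<sigma> + \<sigma> / C_low P"

definition sufficient_step :: "'n far2_state \<Rightarrow> real^'n \<Rightarrow> bool" where
  "sufficient_step S s \<longleftrightarrow>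
     s \<noteq> 0 \<and>
     decrease_const * sigma S * norm s ^ 3 \<le> predicted_decrease S s \<and>
     norm (model_residual S s) \<le> residual_const (sigma S) * (norm s)\<^sup>2"

lemma decrease_const_pos: "0 < decrease_const"
  using params_pos by (simp add: decrease_const_def)

lemma small_model_gradient_imp_residual_le:
  assumes "small_model_gradient P f S s" and "0 < sigma S"
  shows "norm (model_residual S s) \<le> residual_const (sigma S) * (norm s)\<^sup>2"
proof -
  let ?r = "model_residual S s" and ?c = "(sigma S * norm s) *\<^sub>R s"
  have "norm ?r \<le> norm (?r + ?c) + norm ?c"
    using norm_triangle_ineq4[of "?r + ?c" ?c] by simp
  also have "\<dots> \<le> 1/2 * theta1 P * (norm s)\<^sup>2 + sigma S * (norm s)\<^sup>2"
    using assms by (intro add_mono)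
      (auto simp: small_model_gradient_def power2_eq_square
        grad_cubic_model[OF differentiable grad_differentiable])
  also have "\<dots> \<le> residual_const (sigma S) * (norm s)\<^sup>2"
    using assms params_pos by (simp add: residual_const_def distrib_right)
  finally show ?thesis .
qed

lemma subspace_step_sufficient:
  assumes min: "subspace_min P f S lam sh W V'"
    and small: "small_model_gradient P f S (cols_mult W sh)"
    and grad_nonzero: "grad f (iterate S) \<noteq> 0" and \<sigma>_pos: "0 < sigma S"
  shows "sufficient_step S (cols_mult W sh)"
proof -
  define s where "s = cols_mult W sh"
  have galerkin: "galerkin_step (hess f (iterate S)) (grad f (iterate S)) lam s"
    unfolding s_def using min grad_nonzero by (rule subspace_min_galerkin)
  have "decrease_const * sigma S * norm s ^ 3 \<le> 1/2 * sigma S * norm s ^ 3"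
    using \<sigma>_pos by (intro mult_right_mono) (auto simp: decrease_const_def min_def)
  also have "\<dots> = lam / 2 * (norm s)\<^sup>2"
    using subspace_min_lam[OF min] subspace_min_norm[OF min]
    by (simp add: s_def power2_eq_square power3_eq_cube)
  also have "\<dots> \<le> predicted_decrease S s"
    using galerkin by (rule galerkin_step_quad_model_decrease)
  finally show ?thesis
    using small_model_gradient_imp_residual_le[OF small \<sigma>_pos] galerkin_step_nonzero[OF galerkin]
    by (simp add: sufficient_step_def s_def)
qed

lemma newton_step_sufficient:
  assumes newton: "newton_step (hess f (iterate S)) (grad f (iterate S)) (sigma S * h) s"
    and curvature: "0 < s \<bullet> (shifted (hess f (iterate S)) (sigma S * h) *v s)"
    and ratio: "C_low P * h \<le> norm s" "norm s \<le> C_up P * h" and \<sigma>_pos: "0 < sigma S"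
  shows "sufficient_step S s"
proof -
  have galerkin: "galerkin_step (hess f (iterate S)) (grad f (iterate S)) (sigma S * h) s"
    using newton curvature by (rule newton_step_galerkin)
  have h_bounds: "norm s / C_up P \<le> h" "h \<le> norm s / C_low P"
    using ratio params_pos by (simp_all add: field_simps)
  have "0 < norm s" using galerkin_step_nonzero[OF galerkin] by simp
  then have "0 < C_up P * h" using ratio(2) by linarith
  then have "0 < h" using params_pos by (simp add: zero_less_mult_iff)
  have "decrease_const * sigma S * norm s ^ 3 \<le> 1 / (2 * C_up P) * sigma S * norm s ^ 3"
    using \<sigma>_pos by (intro mult_right_mono) (auto simp: decrease_const_def)
  also have "\<dots> = sigma S * (norm s / C_up P) / 2 * (norm s)\<^sup>2"
    by (simp add: power2_eq_square power3_eq_cube)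
  also have "\<dots> \<le> sigma S * h / 2 * (norm s)\<^sup>2"
    using h_bounds \<sigma>_pos by (intro mult_right_mono divide_right_mono mult_left_mono) auto
  also have "\<dots> \<le> predicted_decrease S s"
    using galerkin by (rule galerkin_step_quad_model_decrease)
  finally have decrease: "decrease_const * sigma S * norm s ^ 3 \<le> predicted_decrease S s" .
  have "norm (model_residual S s) = sigma S * h * norm s"
    unfolding newton_step_residual[OF newton] using \<open>0 < h\<close> \<sigma>_pos by simp
  also have "\<dots> \<le> sigma S * (norm s / C_low P) * norm s"
    using h_bounds \<sigma>_pos by (intro mult_right_mono mult_left_mono) auto
  also have "\<dots> = sigma S / C_low P * (norm s)\<^sup>2" by (simp add: power2_eq_square)
  also have "\<dots> \<le> residual_const (sigma S) * (norm s)\<^sup>2"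
    using \<sigma>_pos params_pos by (intro mult_right_mono) (auto simp: residual_const_def)
  finally show ?thesis
    using decrease galerkin_step_nonzero[OF galerkin] by (simp add: sufficient_step_def)
qed

lemma cubic_decrease_step_sufficient:
  assumes decrease: "cubic_model f (iterate S) (sigma S) s < cubic_model f (iterate S) (sigma S) 0"
    and small: "small_model_gradient P f S s" and \<sigma>_pos: "0 < sigma S"
  shows "sufficient_step S s"
proof -
  have "decrease_const * sigma S * norm s ^ 3 \<le> 1/3 * sigma S * norm s ^ 3"
    using \<sigma>_pos by (intro mult_right_mono) (auto simp: decrease_const_def)
  also have "\<dots> \<le> predicted_decrease S s"
    using decrease by (simp add: cubic_model_def)
  finally show ?thesis
    using small_model_gradient_imp_residual_le[OF small \<sigma>_pos] decrease
    by (auto simp: sufficient_step_def)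
qed

lemma compute_step_sufficient:
  assumes "compute_step P f S (Some s) V'"
    and grad_nonzero: "grad f (iterate S) \<noteq> 0" and \<sigma>_pos: "0 < sigma S"
  shows "sufficient_step S s"
  using assms(1)
proof cases
  case (subspace_accepted lamh sh W)
  then show ?thesis using subspace_step_sufficient grad_nonzero \<sigma>_pos by blast
next
  case (newton_accepted lamh sh W)
  have "cols_mult W sh \<noteq> 0"
    using subspace_min_galerkin[OF newton_accepted(1) grad_nonzero] by (rule galerkin_step_nonzero)
  then have pos: "0 < euclid_norm sh" by (simp flip: subspace_min_norm[OF newton_accepted(1)])
  have lamh: "lamh = sigma S * euclid_norm sh"
    using newton_accepted(1) by (rule subspace_min_lam)
  have curvature: "0 < s \<bullet> (shifted (hess f (iterate S)) lamh *v s)"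
    and "C_low P \<le> norm s / euclid_norm sh" "norm s / euclid_norm sh \<le> C_up P"
    using newton_accepted(4) unfolding newton_rejected_def by linarith+
  then have ratio: "C_low P * euclid_norm sh \<le> norm s" "norm s \<le> C_up P * euclid_norm sh"
    using pos by (simp_all add: pos_le_divide_eq pos_divide_le_eq)
  show ?thesis
    using newton_accepted(3) curvature ratio \<sigma>_pos unfolding lamh by (rule newton_step_sufficient)
next
  case recomputed
  then show ?thesis using cubic_decrease_step_sufficient \<sigma>_pos by blast
qed

definition gradient_const :: real where
  "gradient_const = L2 / 2 + residual_const (sigma_max P L2)"

definition progress_const :: real where
  "progress_const = eta1 P * decrease_const * sigma_min P / gradient_const powr (3/2)"

lemma sigma0_le_sigma_max: "sigma0 P \<le> sigma_max P L2"
  by (simp add: sigma_max_def)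

lemma gradient_const_pos: "0 < gradient_const"
proof -
  have "0 < sigma_max P L2" using sigma0_le_sigma_max sigma0_pos by linarith
  then have "0 < residual_const (sigma_max P L2)"
    using params_pos unfolding residual_const_def by (intro add_pos_pos divide_pos_pos) auto
  then show ?thesis using lipschitz_constant_nonneg by (simp add: gradient_const_def)
qed

lemma progress_const_pos: "0 < progress_const"
  using gradient_const_pos decrease_const_pos params_pos by (simp add: progress_const_def)

lemma sufficient_step_predicted_decrease_pos:
  assumes "sufficient_step S s" and "0 < sigma S"
  shows "0 < predicted_decrease S s"
proof -
  have "0 < decrease_const * sigma S * norm s ^ 3"
    using assms decrease_const_pos by (simp add: sufficient_step_def)
  with assms(1) show ?thesis unfolding sufficient_step_def by linarith
qed

lemma gradient_after_sufficient_step: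
  assumes step: "sufficient_step S s" and \<sigma>_le: "sigma S \<le> sigma_max P L2"
  shows "norm (grad f (iterate S + s)) \<le> gradient_const * (norm s)\<^sup>2"
proof -
  define x where "x = iterate S"
  have "norm (grad f x + hess f x *v s) \<le> residual_const (sigma S) * (norm s)\<^sup>2"
    using step by (simp add: sufficient_step_def x_def)
  also have "\<dots> \<le> residual_const (sigma_max P L2) * (norm s)\<^sup>2"
    using \<sigma>_le params_pos unfolding residual_const_def
    by (intro mult_right_mono add_mono divide_right_mono) auto
  finally have residual:
    "norm (grad f x + hess f x *v s) \<le> residual_const (sigma_max P L2) * (norm s)\<^sup>2" .
  have "norm (grad f (x + s))
      \<le> norm (grad f (x + s) - grad f x - hess f x *v s) + norm (grad f x + hess f x *v s)"
    using norm_triangle_ineq[of "grad f (x + s) - grad f x - hess f x *v s"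
        "grad f x + hess f x *v s"] by simp
  also have "\<dots> \<le> L2 / 2 * (norm s)\<^sup>2 + residual_const (sigma_max P L2) * (norm s)\<^sup>2"
    using grad_linearization_error residual by (rule add_mono)
  finally show ?thesis by (simp add: gradient_const_def x_def distrib_right)
qed

lemma successful_step_decrease:
  assumes step: "sufficient_step S s" and \<sigma>_range: "sigma S \<in> sigma_range"
    and success: "eta1 P \<le> rho f (iterate S) s"
  shows "f (iterate S + s) + progress_const * norm (grad f (iterate S + s)) powr (3/2)
    \<le> f (iterate S)"
proof -
  define \<Delta> where "\<Delta> = predicted_decrease S s"
  have "s \<noteq> 0" and decrease: "decrease_const * sigma S * norm s ^ 3 \<le> \<Delta>"
    using step by (auto simp: sufficient_step_def \<Delta>_def)
  have \<Delta>: "0 < \<Delta>"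
    unfolding \<Delta>_def using sufficient_step_predicted_decrease_pos step \<sigma>_range params_pos by auto
  have "norm (grad f (iterate S + s)) powr (3/2) \<le> (gradient_const * (norm s)\<^sup>2) powr (3/2)"
    using gradient_after_sufficient_step[OF step] \<sigma>_range by (intro powr_mono2) auto
  also have "\<dots> = gradient_const powr (3/2) * norm s ^ 3"
  proof -
    have "(norm s)\<^sup>2 powr (3/2) = norm s ^ 3"
      using \<open>s \<noteq> 0\<close> by (simp add: powr_powr flip: powr_numeral)
    then show ?thesis using gradient_const_pos by (simp add: powr_mult)
  qed
  finally have "progress_const * norm (grad f (iterate S + s)) powr (3/2)
      \<le> progress_const * (gradient_const powr (3/2) * norm s ^ 3)"
    using progress_const_pos by (intro mult_left_mono) auto
  also have "\<dots> = eta1 P * (decrease_const * sigma_min P * norm s ^ 3)"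
    using gradient_const_pos by (simp add: progress_const_def)
  also have "\<dots> \<le> eta1 P * (decrease_const * sigma S * norm s ^ 3)"
    using params_pos decrease_const_pos \<sigma>_range by (intro mult_left_mono mult_right_mono) auto
  also have "\<dots> \<le> eta1 P * \<Delta>" using decrease params_pos by (intro mult_left_mono) auto
  also have "\<dots> \<le> f (iterate S) - f (iterate S + s)"
    using success \<Delta> by (simp add: rho_def \<Delta>_def[symmetric] field_simps)
  finally show ?thesis by simp
qed

lemma rejection_threshold_le_sigma_max:
  "gamma2 P * (L2 / (6 * (1 - eta1 P) * decrease_const)) \<le> sigma_max P L2"
proof (cases "1/3 \<le> 1 / (2 * C_up P)")
  case True
  then have denominator: "6 * (1 - eta1 P) * decrease_const = 2 * (1 - eta1 P)"
    by (simp add: decrease_const_def)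
  show ?thesis unfolding denominator by (simp add: sigma_max_def)
next
  case False
  then have denominator: "6 * (1 - eta1 P) * decrease_const = 3 * (1 - eta1 P) / C_up P"
    using params_pos by (simp add: decrease_const_def min_def field_simps)
  show ?thesis unfolding denominator by (simp add: sigma_max_def)
qed

lemma unsuccessful_step_sigma_le:
  assumes step: "sufficient_step S s" and \<sigma>_pos: "0 < sigma S"
    and fail: "rho f (iterate S) s < eta1 P"
  shows "gamma2 P * sigma S \<le> sigma_max P L2"
proof -
  define x where "x = iterate S"
  define \<Delta> where "\<Delta> = predicted_decrease S s"
  have "s \<noteq> 0" and decrease: "decrease_const * sigma S * norm s ^ 3 \<le> \<Delta>"
    using step by (auto simp: sufficient_step_def \<Delta>_def)
  have "0 < \<Delta>" unfolding \<Delta>_def using step \<sigma>_pos by (rule sufficient_step_predicted_decrease_pos)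
  then have "f x - f (x + s) < eta1 P * \<Delta>"
    using fail by (simp add: rho_def \<Delta>_def[symmetric] x_def field_simps)
  moreover have "f (x + s) \<le> quad_model f x s + L2 / 6 * norm s ^ 3"
    using quad_model_error[of x s] by linarith
  moreover have "\<Delta> = f x - quad_model f x s" by (simp add: \<Delta>_def x_def quad_model_def)
  ultimately have "\<Delta> - eta1 P * \<Delta> < L2 / 6 * norm s ^ 3" by linarith
  then have "(1 - eta1 P) * \<Delta> < L2 / 6 * norm s ^ 3" by (simp add: left_diff_distrib)
  then have "(1 - eta1 P) * (decrease_const * sigma S * norm s ^ 3) < L2 / 6 * norm s ^ 3"
    using mult_left_mono[OF decrease, of "1 - eta1 P"] eta1_less_1 by linarith
  then have "((1 - eta1 P) * decrease_const * sigma S) * norm s ^ 3 < L2 / 6 * norm s ^ 3"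
    by (simp add: mult.assoc)
  then have "(1 - eta1 P) * decrease_const * sigma S < L2 / 6"
    using \<open>s \<noteq> 0\<close> by (simp add: mult_less_cancel_right)
  then have "sigma S \<le> L2 / (6 * (1 - eta1 P) * decrease_const)"
    using eta1_less_1 decrease_const_pos by (simp add: field_simps)
  then have "gamma2 P * sigma S \<le> gamma2 P * (L2 / (6 * (1 - eta1 P) * decrease_const))"
    using gamma2_gt_1 by (intro mult_left_mono) auto
  also note rejection_threshold_le_sigma_max
  finally show ?thesis .
qed

lemma far2_iteration_cases:
  assumes iteration: "far2_iteration P f S b S'" and grad_nonzero: "grad f (iterate S) \<noteq> 0"
    and \<sigma>_range: "sigma S \<in> sigma_range"
  obtains
    (abandoned) "\<not> b" "\<not> refresh S" "refresh S'" "iterate S' = iterate S" "sigma S' = sigma S"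
  | (successful) "b" "\<not> refresh S'" "sigma S' \<in> sigma_range"
      "gamma1 P * sigma S \<le> sigma S'"
      "f (iterate S') + progress_const * norm (grad f (iterate S')) powr (3/2) \<le> f (iterate S)"
  | (rejected) "\<not> b" "\<not> refresh S'" "sigma S' \<in> sigma_range"
      "iterate S' = iterate S" "sigma S' = gamma2 P * sigma S"
  using iteration
proof cases
  case (abandoned_iteration V')
  moreover from abandoned_iteration have "\<not> refresh S" by (auto elim: compute_step.cases)
  ultimately show ?thesis by (intro abandoned) auto
next
  case (tested_iteration s V' \<sigma>')
  have \<sigma>_pos: "0 < sigma S" using \<sigma>_range params_pos by auto
  have step: "sufficient_step S s"
    using tested_iteration(2) grad_nonzero \<sigma>_pos by (rule compute_step_sufficient)
  show ?thesis
  proof (cases b)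
    case True
    then have "gamma1 P * sigma S \<le> \<sigma>'" "sigma_min P \<le> \<sigma>'" "\<sigma>' \<le> sigma S"
      using tested_iteration(3,4) \<sigma>_range \<sigma>_pos params_order params_pos unfolding sigma_update_def
      by (auto split: if_splits intro: mult_left_le_one_le)
    with True show ?thesis
      using tested_iteration \<sigma>_range successful_step_decrease[OF step \<sigma>_range]
      by (intro successful) auto
  next
    case False
    then have fail: "rho f (iterate S) s < eta1 P" using tested_iteration by simp
    then have "\<sigma>' = gamma2 P * sigma S"
      using tested_iteration(4) params_order by (auto simp: sigma_update_def)
    moreover have "sigma S \<le> gamma2 P * sigma S" using \<sigma>_pos params_order by simp
    ultimately show ?thesis
      using False tested_iteration \<sigma>_range unsuccessful_step_sigma_le[OF step \<sigma>_pos fail]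
      by (intro rejected) auto
  qed
qed

end


section \<open>Runs\<close>

lemma card_Collect_less_Suc:
  "card {i. i < Suc k \<and> Q i} = card {i. i < k \<and> Q i} + (if Q k then 1 else 0)"
proof -
  have "{i. i < Suc k \<and> Q i} = {i. i < k \<and> Q i} \<union> (if Q k then {k} else {})"
    by (auto simp: less_Suc_eq)
  then show ?thesis by simp
qed

lemma first_index_if_bounded:
  fixes B :: real
  assumes "\<And>k. \<forall>i<k. \<not> Q i \<Longrightarrow> real k \<le> B"
  obtains k where "Q k" and "\<forall>i<k. \<not> Q i"
proof -
  have "\<exists>k. Q k"
  proof (rule ccontr)
    assume "\<nexists>k. Q k"
    then have "real k \<le> B" for k using assms by blast
    then show False using reals_Archimedean2 by (meson not_less)
  qed
  then show thesis using that exists_least_iff[of Q] by blast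
qed

text \<open>The factor \<open>4/3\<close> is the ratio of \<open>2\<close> and \<open>3/2\<close>, and the additive constants are charged to a
  multiple of \<open>E = \<epsilon> powr (-3/2) \<ge> 1\<close>. The value at \<open>D = 0\<close> is arbitrary.\<close>

definition absorbing_const :: "real \<Rightarrow> real \<Rightarrow> real \<Rightarrow> real" where
  "absorbing_const D \<kappa> b = (if D = 0 then 1 else D / (4/3 * (D / \<kappa> + 1) + b / 3))"

lemma absorbing_const_pos:
  assumes "0 \<le> D" "0 < \<kappa>" "0 \<le> b"
  shows "0 < absorbing_const D \<kappa> b"
proof -
  have "0 < 4/3 * (D / \<kappa> + 1) + b / 3"
    using assms by (intro add_pos_nonneg mult_pos_pos add_nonneg_pos) auto
  then show ?thesis using assms(1) by (simp add: absorbing_const_def)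
qed

lemma absorbing_const_le:
  assumes "0 < D" "0 < \<kappa>" "0 \<le> b" "1 \<le> E" "n \<le> D / \<kappa> * E + 1"
  shows "4/3 * n + b / 3 \<le> D / absorbing_const D \<kappa> b * E"
proof -
  have "b / 3 \<le> b / 3 * E" using mult_left_mono[OF assms(4), of "b / 3"] assms(3) by simp
  moreover have "n \<le> D / \<kappa> * E + E" using assms(4,5) by linarith
  ultimately have "4/3 * n + b / 3 \<le> 4/3 * (D / \<kappa> * E + E) + b / 3 * E"
    by (intro add_mono mult_left_mono) auto
  also have "\<dots> = (4/3 * (D / \<kappa> + 1) + b / 3) * E" by (simp add: algebra_simps)
  also have "\<dots> = D / absorbing_const D \<kappa> b * E" using assms(1) by (simp add: absorbing_const_def)
  finally show ?thesis .
qed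

locale far2_execution = far2 f L2 P
  for f :: "real^'n \<Rightarrow> real" and L2 :: real and P :: far2_params +
  fixes x0 :: "real^'n" and \<epsilon> :: real and S :: "nat \<Rightarrow> 'n far2_state" and succ :: "nat \<Rightarrow> bool"
  assumes \<epsilon>_pos: "0 < \<epsilon>"
    and run: "far2_run P f x0 \<epsilon> S succ"
begin

definition running :: "nat \<Rightarrow> bool" where
  "running k \<longleftrightarrow> (\<forall>i<k. \<not> norm (grad f (iterate (S i))) \<le> \<epsilon>)"

definition successes :: "nat \<Rightarrow> nat" where
  "successes k = card {i. i < k \<and> succ i}"

definition rejections :: "nat \<Rightarrow> nat" where
  "rejections k = card {i. i < k \<and> \<not> succ i \<and> \<not> refresh (S (Suc i))}"

lemma running_Suc: "running (Suc k) \<longleftrightarrow> running k \<and> \<not> norm (grad f (iterate (S k))) \<le> \<epsilon>"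
  by (auto simp: running_def less_Suc_eq)

lemma initial_state: "S 0 = \<lparr>iterate = x0, sigma = sigma0 P, refresh = True, basis = []\<rparr>"
  using run by (simp add: far2_run_def)

lemma successes_Suc: "successes (Suc k) = successes k + (if succ k then 1 else 0)"
  unfolding successes_def by (rule card_Collect_less_Suc)

lemma rejections_Suc:
  "rejections (Suc k) = rejections k + (if \<not> succ k \<and> \<not> refresh (S (Suc k)) then 1 else 0)"
  unfolding rejections_def by (rule card_Collect_less_Suc)

lemma counters_0: "successes 0 = 0" "rejections 0 = 0"
  by (simp_all add: successes_def rejections_def)

lemma running_iteration:
  assumes "running (Suc k)"
  shows "far2_iteration P f (S k) (succ k) (S (Suc k))" and "grad f (iterate (S k)) \<noteq> 0"
  using assms run \<epsilon>_pos by (auto simp: far2_run_def running_def less_Suc_eq_le)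

lemma sigma_bounds: "running k \<Longrightarrow> sigma (S k) \<in> sigma_range"
proof (induction k)
  case 0
  then show ?case using params_order sigma0_le_sigma_max by (simp add: initial_state)
next
  case (Suc k)
  then have "sigma (S k) \<in> sigma_range" by (simp add: running_Suc)
  with running_iteration[OF Suc.prems] show ?case
    by (cases rule: far2_iteration_cases) (use Suc in \<open>auto simp: running_Suc\<close>)
qed

lemma sigma_lower_bound:
  "running k \<Longrightarrow> sigma0 P * gamma1 P ^ successes k * gamma2 P ^ rejections k \<le> sigma (S k)"
proof (induction k)
  case 0
  then show ?case by (simp add: initial_state counters_0)
next
  case (Suc k)
  let ?l = "sigma0 P * gamma1 P ^ successes k * gamma2 P ^ rejections k"
  have running: "running k" using Suc.prems by (simp add: running_Suc)
  then have lower: "?l \<le> sigma (S k)" by (rule Suc.IH)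
  from running_iteration[OF Suc.prems] sigma_bounds[OF running] show ?case
  proof (cases rule: far2_iteration_cases)
    case abandoned
    with lower show ?thesis by (simp add: successes_Suc rejections_Suc)
  next
    case successful
    have "gamma1 P * ?l \<le> gamma1 P * sigma (S k)"
      using lower params_pos by (intro mult_left_mono) auto
    with successful show ?thesis by (simp add: successes_Suc rejections_Suc ac_simps)
  next
    case rejected
    have "gamma2 P * ?l \<le> gamma2 P * sigma (S k)"
      using lower params_order by (intro mult_left_mono) auto
    with rejected show ?thesis by (simp add: successes_Suc rejections_Suc ac_simps)
  qed
qed

lemma iterations_le_twice_tested:
  "running k \<Longrightarrow> k + (if refresh (S k) then 0 else 1) \<le> 2 * (successes k + rejections k)"
proof (induction k)
  case 0
  then show ?case by (simp add: initial_state)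
next
  case (Suc k)
  have running: "running k" using Suc.prems by (simp add: running_Suc)
  from running_iteration[OF Suc.prems] sigma_bounds[OF running] show ?case
    by (cases rule: far2_iteration_cases)
      (use Suc.IH[OF running] in \<open>auto simp: successes_Suc rejections_Suc split: if_splits\<close>)
qed

lemma objective_decrease:
  "running (Suc k) \<Longrightarrow>
    f (iterate (S k)) + progress_const * \<epsilon> powr (3/2) * successes k \<le> f x0"
proof (induction k)
  case 0
  then show ?case by (simp add: initial_state counters_0)
next
  case (Suc k)
  have running: "running (Suc k)" using Suc.prems by (simp add: running_Suc)
  note IH = Suc.IH[OF running]
  have "running k" using running by (simp add: running_Suc)
  from running_iteration[OF running] sigma_bounds[OF this] show ?case
  proof (cases rule: far2_iteration_cases)
    case successful
    have "progress_const * \<epsilon> powr (3/2)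
        \<le> progress_const * norm (grad f (iterate (S (Suc k)))) powr (3/2)"
      using Suc.prems \<epsilon>_pos progress_const_pos
      by (intro mult_left_mono powr_mono2) (auto simp: running_Suc)
    with successful IH show ?thesis by (simp add: successes_Suc distrib_left)
  qed (use IH in \<open>simp_all add: successes_Suc\<close>)
qed

lemma successes_bound:
  assumes "AS2 f f_low" and "running k"
  shows "real (successes k) \<le> (f x0 - f_low) / progress_const * \<epsilon> powr (-3/2) + 1"
proof (cases k)
  case 0
  then show ?thesis
    using assms(1) progress_const_pos by (simp add: counters_0 AS2_def)
next
  case (Suc m)
  have "f_low + progress_const * \<epsilon> powr (3/2) * successes m \<le> f x0"
    using add_right_mono[of f_low "f (iterate (S m))"] objective_decrease[of m] assms Suc
    unfolding AS2_def by (meson order_trans)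
  then have "successes m \<le> (f x0 - f_low) / (progress_const * \<epsilon> powr (3/2))"
    using progress_const_pos \<epsilon>_pos by (simp add: field_simps)
  also have "\<dots> = (f x0 - f_low) / progress_const * \<epsilon> powr (-3/2)"
    using powr_minus_divide[of \<epsilon> "3/2"] by simp
  finally show ?thesis using Suc by (simp add: successes_Suc)
qed

lemma rejections_bound:
  assumes "running k"
  shows "real (rejections k) \<le> successes k * (\<bar>ln (gamma1 P)\<bar> / ln (gamma2 P))
           + ln (sigma_max P L2 / sigma0 P) / ln (gamma2 P)"
proof -
  have "sigma0 P * gamma1 P ^ successes k * gamma2 P ^ rejections k \<le> sigma_max P L2"
    using sigma_lower_bound[OF assms] sigma_bounds[OF assms] by simp
  then have "gamma1 P ^ successes k * gamma2 P ^ rejections k \<le> sigma_max P L2 / sigma0 P"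
    using params_pos by (simp add: field_simps)
  then have "ln (gamma1 P ^ successes k * gamma2 P ^ rejections k) \<le> ln (sigma_max P L2 / sigma0 P)"
    using params_pos params_order by (intro ln_mono) auto
  then have "successes k * ln (gamma1 P) + rejections k * ln (gamma2 P)
      \<le> ln (sigma_max P L2 / sigma0 P)"
    using params_pos params_order by (simp add: ln_mult ln_realpow)
  then have "rejections k * ln (gamma2 P)
      \<le> successes k * \<bar>ln (gamma1 P)\<bar> + ln (sigma_max P L2 / sigma0 P)"
    using params_pos params_order by (simp add: abs_if)
  then show ?thesis
    using params_order by (simp add: pos_le_divide_eq flip: add_divide_distrib)
qed

lemma iterations_bound:
  assumes "running k"
  shows "real k \<le> 2 * (1 + \<bar>ln (gamma1 P)\<bar> / ln (gamma2 P)) * successes k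
           + 2 * (ln (sigma_max P L2 / sigma0 P) / ln (gamma2 P))"
proof -
  have "k \<le> 2 * (successes k + rejections k)"
    using iterations_le_twice_tested[OF assms] by linarith
  then have "real k \<le> 2 * (real (successes k) + real (rejections k))"
    using of_nat_mono[of k _, where 'a = real] by fastforce
  with rejections_bound[OF assms] show ?thesis by (simp add: algebra_simps)
qed

lemma running_from_minimum:
  assumes "AS2 f (f x0)" and "running k"
  shows "k = 0"
proof (rule ccontr)
  assume "k \<noteq> 0"
  have "grad f x0 = 0"
    using GDERIV_grad[OF differentiable] assms(1) unfolding AS2_def
    by (blast intro: GDERIV_eq_0_at_minimum)
  with \<open>k \<noteq> 0\<close> show False using assms(2) \<epsilon>_pos by (auto simp: running_def initial_state)
qed

lemma iteration_complexity:
  assumes AS2: "AS2 f f_low" and "\<epsilon> < 1" and running: "running k"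
  defines "r \<equiv> \<bar>ln (gamma1 P)\<bar> / ln (gamma2 P)"
    and "b \<equiv> ln (sigma_max P L2 / sigma0 P) / ln (gamma2 P)"
  defines "N \<equiv> \<lceil>(f x0 - f_low) / absorbing_const (f x0 - f_low) progress_const b
                 * \<epsilon> powr (-3/2) + 1\<rceil>"
  shows "int (successes k) \<le> N \<and> real k \<le> N * (3/2 + 3/2 * r) + 3/2 * b"
proof -
  have r_nonneg: "0 \<le> r"
    unfolding r_def using params_order by (intro divide_nonneg_nonneg) auto
  have b_nonneg: "0 \<le> b"
    unfolding b_def using params_pos params_order sigma0_le_sigma_max by simp
  show ?thesis
  proof (cases "f x0 = f_low")
    case True
    then have "k = 0" using running_from_minimum AS2 running by blast
    then show ?thesis using r_nonneg b_nonneg True by (simp add: N_def counters_0)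
  next
    case False
    with AS2 have "0 < f x0 - f_low" by (simp add: AS2_def less_le)
    moreover have "1 \<le> \<epsilon> powr (-3/2)" using powr_mono2'[of "-3/2" \<epsilon> 1] \<epsilon>_pos \<open>\<epsilon> < 1\<close> by simp
    ultimately have N_ge: "4/3 * successes k + b / 3 \<le> N"
      using absorbing_const_le[OF _ progress_const_pos b_nonneg _ successes_bound[OF AS2 running]]
      unfolding N_def by linarith
    have "real k \<le> 2 * (1 + r) * successes k + 2 * b"
      using iterations_bound[OF running] by (simp add: r_def b_def)
    also have "\<dots> \<le> 3/2 * (1 + r) * (4/3 * successes k + b / 3) + 3/2 * b"
      using mult_nonneg_nonneg[OF r_nonneg b_nonneg] by (simp add: field_simps)
    also have "\<dots> \<le> 3/2 * (1 + r) * N + 3/2 * b"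
      using N_ge r_nonneg by (intro add_right_mono mult_left_mono) auto
    finally have "real k \<le> N * (3/2 + 3/2 * r) + 3/2 * b" by (simp add: field_simps)
    moreover have "int (successes k) \<le> N" using N_ge b_nonneg by linarith
    ultimately show ?thesis by blast
  qed
qed

lemma first_iterate_below_tolerance:
  assumes "AS2 f f_low" and "\<epsilon> < 1"
  obtains k where "norm (grad f (iterate (S k))) \<le> \<epsilon>" and "running k"
  using first_index_if_bounded[of "\<lambda>k. norm (grad f (iterate (S k))) \<le> \<epsilon>", folded running_def,
      OF conjunct2[OF iteration_complexity[OF assms]]] that by blast

end

theorem theorem4p5:
  fixes f :: "real^'n \<Rightarrow> real" and x0 :: "real^'n" and L1 L2 f_low :: real
    and P :: far2_params
  assumes "AS1 f L1 L2" and "AS2 f f_low" and "valid_params TYPE('n) P"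
  shows "\<exists>\<kappa>\<^sub>p>0. \<forall>\<epsilon>\<in>{0<..<1}. \<forall>S succ. far2_run P f x0 \<epsilon> S succ \<longrightarrow>
    (\<exists>k. norm (grad f (iterate (S k))) \<le> \<epsilon> \<and>
         (\<forall>i<k. \<not> norm (grad f (iterate (S i))) \<le> \<epsilon>) \<and>
         int (card {i. i < k \<and> succ i}) \<le> \<lceil>(f x0 - f_low) / \<kappa>\<^sub>p * \<epsilon> powr (-3/2) + 1\<rceil> \<and>
         real k \<le> real_of_int \<lceil>(f x0 - f_low) / \<kappa>\<^sub>p * \<epsilon> powr (-3/2) + 1\<rceil>
                    * (3/2 + 3/2 * (\<bar>ln (gamma1 P)\<bar> / ln (gamma2 P)))
                  + 3 / (2 * ln (gamma2 P)) * ln (sigma_max P L2 / sigma0 P))"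
    (is "\<exists>\<kappa>\<^sub>p>0. \<forall>\<epsilon>\<in>_. \<forall>S succ. _ \<longrightarrow> ?complexity \<kappa>\<^sub>p \<epsilon> S succ")
proof -
  interpret far2 f L2 P
    using AS1_imp_lipschitz_hessian[OF assms(1)] assms(3) by (intro far2.intro far2_axioms.intro)
  let ?b = "ln (sigma_max P L2 / sigma0 P) / ln (gamma2 P)"
  let ?\<kappa>\<^sub>p = "absorbing_const (f x0 - f_low) progress_const ?b"
  have "0 \<le> f x0 - f_low" "0 \<le> ?b"
    using assms(2) params_pos params_order sigma0_le_sigma_max by (auto simp: AS2_def)
  then have "0 < ?\<kappa>\<^sub>p" by (intro absorbing_const_pos progress_const_pos)
  moreover have "?complexity ?\<kappa>\<^sub>p \<epsilon> S succ"
    if \<epsilon>: "\<epsilon> \<in> {0<..<1}" and run: "far2_run P f x0 \<epsilon> S succ" for \<epsilon> S succ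
  proof -
    interpret far2_execution f L2 P x0 \<epsilon> S succ using \<epsilon> run by unfold_locales auto
    obtain k where "norm (grad f (iterate (S k))) \<le> \<epsilon>" and "running k"
      using first_iterate_below_tolerance[OF assms(2)] \<epsilon> by auto
    then show ?thesis
      using iteration_complexity[OF assms(2) _ \<open>running k\<close>] \<epsilon>
      by (auto simp: running_def successes_def)
  qed
  ultimately show ?thesis by blast
qed

end
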